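(* Let $P$ be a convex polygon in the plane with vertices $y_1,\ldots,y_n$ listed in cyclic order along its boundary. Let $T$ be a triangulation of a planar polygon $M$ (possibly with holes). Then for any $y\in P$ and any labelling $L:V(T)\to\{1,\ldots,n\}$ with $L\in\mathrm{NL}(T,n)$, the triangulation $T$ contains at least $|\deg(L,\partial T)|$ triangles that are labelled as triangles in $\operatorname{cov}_P(y)$.
   Context: A planar polygon with holes $M$ is the closed region inside or on an outer simple polygon $H_0$ and outside or on the boundaries of polygons $H_1,\ldots,H_k$ (holes) lying inside $H_0$, where the boundaries of $H_0,\ldots,H_k$ are pairwise disjoint ($k=0$ allowed). $T$ is a triangulation of $M$ with vertex set $V(T)$; its boundary $\partial T$ is the disjoint union of the polygonal cycles $H_0,\ldots,H_k$. The vertices $v_{01},\ldots,v_{0m_0}$ of $H_0$ are taken in counterclockwise order and the vertices $v_{i1},\ldots,v_{im_i}$ of $H_i$ ($i>0$) in clockwise order (so the interior of $M$ is always on the left). Let $L_i$ be the restriction of $L$ to the cyclic sequence of vertices of $H_i$. Neighboring labelling: labels $1,\ldots,n$ are in cyclic order ($j$ and $j+1$ are neighbors, and $n$ and $1$ are neighbors). A labelling $L$ of a cyclic sequence $v_1,\ldots,v_m$ (with $v_{m+1}=v_1$) is neighboring if for every $i$ either $L(v_i)=L(v_{i+1})$ or $L(v_i),L(v_{i+1})$ are neighbors. For such $L$, $\deg(L):=p-q$ where $p$ (resp. $q$) is the number of indices $k$ with $L(v_k)=1,L(v_{k+1})=2$ (resp. $L(v_k)=2,L(v_{k+1})=1$).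 We write $L\in\mathrm{NL}(T,n)$ if each $L_i$ ($i=0,\ldots,k$) is neighboring, and then $\deg(L,\partial T):=\deg(L_0)+\cdots+\deg(L_k)$. $\operatorname{cov}_P(y)$ is the collection of all triangles $y_iy_jy_k$ ($1\le i<j<k\le n$) that contain $y$. A triangle of $T$ is "labelled as a triangle in $\operatorname{cov}_P(y)$" if the set of labels of its three vertices equals $\{i,j,k\}$ for some triangle $y_iy_jy_k\in\operatorname{cov}_P(y)$. *)

theory Defs
  imports "HOL-Complex_Analysis.Complex_Analysis"
begin

text \<open>The plane is \<^typ>\<open>complex\<close>, so that orientation can be expressed by the library's
  \<^const>\<open>winding_number\<close>.\<close>

section \<open>Polygons\<close>

fun polygonal_path :: "complex list \<Rightarrow> real \<Rightarrow> complex" where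
  "polygonal_path [] = linepath 0 0"
| "polygonal_path [a] = linepath a a"
| "polygonal_path [a, b] = linepath a b"
| "polygonal_path (a # b # c # vs) = linepath a b +++ polygonal_path (b # c # vs)"

definition polygon_path :: "complex list \<Rightarrow> real \<Rightarrow> complex" where
  "polygon_path vs = polygonal_path (vs @ [hd vs])"

abbreviation polygon_boundary :: "complex list \<Rightarrow> complex set" where
  "polygon_boundary vs \<equiv> path_image (polygon_path vs)"

text \<open>Distinctness of the vertices follows from \<^const>\<open>simple_path\<close>. An angle of 180 degrees at
  a vertex is allowed: the vertices of a boundary polygon will be all the vertices of the
  triangulation lying on it, not only its corners.\<close>

definition simple_polygon :: "complex list \<Rightarrow> bool" where
  "simple_polygon vs \<longleftrightarrow> 3 \<le> length vs \<and> simple_path (polygon_path vs)"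

definition counterclockwise :: "complex list \<Rightarrow> bool" where
  "counterclockwise vs \<longleftrightarrow> (\<forall>z \<in> inside (polygon_boundary vs). winding_number (polygon_path vs) z = 1)"

definition clockwise :: "complex list \<Rightarrow> bool" where
  "clockwise vs \<longleftrightarrow> (\<forall>z \<in> inside (polygon_boundary vs). winding_number (polygon_path vs) z = -1)"

definition polygon_edges :: "complex list \<Rightarrow> complex set set" where
  "polygon_edges vs = {closed_segment (vs ! j) (vs ! (Suc j mod length vs)) | j. j < length vs}"

text \<open>The order of the vertices may be clockwise or counterclockwise. Since the vertices are
  required to be extreme points, angles of 180 degrees are excluded here.\<close>

definition convex_polygon :: "complex set \<Rightarrow> nat \<Rightarrow> (nat \<Rightarrow> complex) \<Rightarrow> bool" where
  "convex_polygon P n y \<longleftrightarrow>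
     (let vs = map y [1..<Suc n] in
        simple_polygon vs \<and>
        P = polygon_boundary vs \<union> inside (polygon_boundary vs) \<and>
        convex P \<and>
        (\<forall>j \<in> {1..n}. y j extreme_point_of P))"

section \<open>Planar polygons with holes and their triangulations\<close>

text \<open>\<open>H 0\<close> is the outer polygon and \<open>H 1, \<dots>, H k\<close> are the holes. The last two conditions fix the
  order in which the vertices are listed.\<close>

definition polygon_with_holes :: "nat \<Rightarrow> (nat \<Rightarrow> complex list) \<Rightarrow> bool" where
  "polygon_with_holes k H \<longleftrightarrow>
     (\<forall>i \<le> k. simple_polygon (H i)) \<and>
     (\<forall>i \<in> {1..k}. polygon_boundary (H i) \<subseteq> inside (polygon_boundary (H 0))) \<and>
     (\<forall>i \<le> k. \<forall>j \<le> k. i \<noteq> j \<longrightarrow> polygon_boundary (H i) \<inter> polygon_boundary (H j) = {}) \<and>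
     counterclockwise (H 0) \<and>
     (\<forall>i \<in> {1..k}. clockwise (H i))"

definition holed_region :: "nat \<Rightarrow> (nat \<Rightarrow> complex list) \<Rightarrow> complex set" where
  "holed_region k H =
     (polygon_boundary (H 0) \<union> inside (polygon_boundary (H 0))) \<inter>
     (\<Inter>i \<in> {1..k}. polygon_boundary (H i) \<union> outside (polygon_boundary (H i)))"

text \<open>A triangulation is a (geometric) simplicial complex in the sense of the library, with its
  edges, vertices and the empty face among its members. The last condition says that the cycles
  \<open>H i\<close> are subcomplexes of \<open>T\<close>; since \<open>T\<close> triangulates the region between them, they then make up
  its boundary, and the vertices of \<open>H i\<close> are exactly the vertices of \<open>T\<close> lying on it. In
  particular no hole is nested in another one, as its vertices would then lie outside the region.\<close>

definition triangulates :: "complex set set \<Rightarrow> nat \<Rightarrow> (nat \<Rightarrow> complex list) \<Rightarrow> bool" where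
  "triangulates T k H \<longleftrightarrow>
     simplicial_complex T \<and>
     \<Union>T = holed_region k H \<and>
     (\<forall>i \<le> k. polygon_edges (H i) \<subseteq> T)"

definition vertices :: "complex set set \<Rightarrow> complex set" where
  "vertices T = {v. {v} \<in> T}"

definition triangles :: "complex set set \<Rightarrow> complex set set" where
  "triangles T = {S \<in> T. 2 simplex S}"

section \<open>Neighboring labellings and their degree\<close>

definition neighbors :: "nat \<Rightarrow> nat \<Rightarrow> nat \<Rightarrow> bool" where
  "neighbors n a b \<longleftrightarrow> b = a + 1 \<or> a = b + 1 \<or> (a = n \<and> b = 1) \<or> (a = 1 \<and> b = n)"

text \<open>A list of labels is read cyclically.\<close>

definition neighboring :: "nat \<Rightarrow> nat list \<Rightarrow> bool" where
  "neighboring n ls \<longleftrightarrow>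
     (\<forall>j < length ls. let a = ls ! j; b = ls ! (Suc j mod length ls) in a = b \<or> neighbors n a b)"

definition label_deg :: "nat list \<Rightarrow> int" where
  "label_deg ls =
     int (card {j. j < length ls \<and> ls ! j = 1 \<and> ls ! (Suc j mod length ls) = 2}) -
     int (card {j. j < length ls \<and> ls ! j = 2 \<and> ls ! (Suc j mod length ls) = 1})"

definition NL :: "nat \<Rightarrow> (nat \<Rightarrow> complex list) \<Rightarrow> nat \<Rightarrow> (complex \<Rightarrow> nat) set" where
  "NL k H n = {L. \<forall>i \<le> k. neighboring n (map L (H i))}"

definition boundary_deg :: "(complex \<Rightarrow> nat) \<Rightarrow> nat \<Rightarrow> (nat \<Rightarrow> complex list) \<Rightarrow> int" where
  "boundary_deg L k H = (\<Sum>i \<le> k. label_deg (map L (H i)))"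

section \<open>Covering triangles\<close>

definition cov :: "nat \<Rightarrow> (nat \<Rightarrow> complex) \<Rightarrow> complex \<Rightarrow> complex set set" where
  "cov n y z =
     {convex hull {y i, y j, y l} | i j l.
        1 \<le> i \<and> i < j \<and> j < l \<and> l \<le> n \<and> z \<in> convex hull {y i, y j, y l}}"

definition labelled_in_cov ::
  "(complex \<Rightarrow> nat) \<Rightarrow> nat \<Rightarrow> (nat \<Rightarrow> complex) \<Rightarrow> complex \<Rightarrow> complex set \<Rightarrow> bool" where
  "labelled_in_cov L n y z S \<longleftrightarrow>
     (\<exists>i j l. 1 \<le> i \<and> i < j \<and> j < l \<and> l \<le> n \<and>
        convex hull {y i, y j, y l} \<in> cov n y z \<and>
        L ` {v. v extreme_point_of S} = {i, j, l})"

end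

theory Submission
  imports Defs
begin

text \<open>Move the point slightly to a point \<open>z'\<close> inside the convex polygon, without entering any
  triangle \<open>y i y j y l\<close> that did not contain it, and shoot a ray from \<open>z'\<close> through the midpoint of
  \<open>y 1\<close> and \<open>y 2\<close>. The signed crossing number of the segment from \<open>y (L u)\<close> to \<open>y (L v)\<close> with this ray is
  antisymmetric in \<open>u, v\<close>. Summed over the boundary edges it gives the degree up to sign; summed over
  the sides of one triangle it lies in \<open>{-1, 0, 1}\<close> and vanishes unless the triangle of the three
  images contains \<open>z'\<close>.

  What remains is that the boundary of the sum of all counterclockwise triangles is the sum of the
  boundary cycles. Both sides have the same winding number around every point off the edges of the
  triangulation, namely the indicator of the region, and the winding number of a chain of segments
  jumps across an edge by the multiplicity of that edge, so the multiplicities agree.\<close>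

section \<open>Chains of segments\<close>

text \<open>Balance makes \<open>M\<close> invariant under reversing every pair, and antisymmetry
  turns the reversed sum into its negative.\<close>

lemma sum_mset_antisym_zero:
  fixes g :: "'a \<Rightarrow> 'a \<Rightarrow> real"
  assumes bal: "\<And>a b. a \<noteq> b \<Longrightarrow> count M (a, b) = count M (b, a)"
    and anti: "\<And>a b. g b a = - g a b"
  shows "(\<Sum>(a, b)\<in>#M. g a b) = 0"
proof -
  have sym: "image_mset prod.swap M = M"
  proof (rule multiset_eqI)
    fix e :: "'a \<times> 'a"
    obtain a b where e: "e = (a, b)" by fastforce
    have "{x. x \<in># M \<and> e = prod.swap x} = (if (b, a) \<in># M then {(b, a)} else {})"
      by (auto simp: e)
    then have "count (image_mset prod.swap M) e = count M (b, a)"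
      by (simp add: count_image_mset' not_in_iff)
    then show "count (image_mset prod.swap M) e = count M e"
      using bal[of a b] e by (cases "a = b") auto
  qed
  have "(\<Sum>(a, b)\<in>#M. g a b) = (\<Sum>(a, b)\<in>#image_mset prod.swap M. g a b)"
    by (simp add: sym)
  also have "\<dots> = (\<Sum>(a, b)\<in>#M. - g a b)"
    by (simp add: image_mset.compositionality o_def case_prod_unfold flip: anti)
  also have "\<dots> = - (\<Sum>(a, b)\<in>#M. g a b)"
    by (induction M) auto
  finally show ?thesis by simp
qed


text \<open>Taking \<open>q\<close> as the midpoint and \<open>h\<close> as half of an edge moves
  the edge to the segment from -1 to 1; lying on a side of a triangle then becomes a linear equation
  in \<open>Re w\<close> and \<open>Im w\<close>.\<close>

lemma affine_in_closed_segmentD: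
  fixes q h w x y :: complex
  assumes "q + w * h \<in> closed_segment (q + x * h) (q + y * h)" "h \<noteq> 0"
  shows "w \<in> closed_segment x y"
proof -
  obtain u where u: "0 \<le> u" "u \<le> 1"
    and eq: "q + w * h = (1 - u) *\<^sub>R (q + x * h) + u *\<^sub>R (q + y * h)"
    using assms(1) by (auto simp: in_segment)
  have "(w - ((1 - u) *\<^sub>R x + u *\<^sub>R y)) * h = 0"
    using eq by (simp add: algebra_simps scaleR_conv_of_real)
  then show ?thesis using u \<open>h \<noteq> 0\<close> by (auto simp: in_segment)
qed

lemma affine_in_convex_hull_iff:
  fixes q h w x y z :: complex
  assumes "h \<noteq> 0"
  shows "q + w * h \<in> convex hull {q + x * h, q + y * h, q + z * h} \<longleftrightarrow> w \<in> convex hull {x, y, z}"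
proof -
  have "linear (\<lambda>w. w * h)" by (rule linearI) (simp_all add: algebra_simps)
  then have "convex hull ((\<lambda>w. q + w) ` ((\<lambda>w. w * h) ` {x, y, z}))
      = (\<lambda>w. q + w) ` (\<lambda>w. w * h) ` (convex hull {x, y, z})"
    by (simp only: convex_hull_translation convex_hull_linear_image)
  then have "convex hull {q + x * h, q + y * h, q + z * h} = (\<lambda>w. q + w * h) ` (convex hull {x, y, z})"
    by (simp add: image_image)
  then show ?thesis using assms by (simp add: image_iff)
qed

text \<open>Near the midpoint of \<open>a b\<close> every term of the sum is continuous except those of \<open>a b\<close> and
  \<open>b a\<close>. Completing \<open>a b\<close> to the triangle \<open>a b c\<close> by two sides that stay away from the midpoint
  shows that the remaining discontinuity is a jump by the net multiplicity of \<open>a b\<close>. The collection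
  \<open>E\<close> may contain segments that do not occur in \<open>M\<close>.\<close>

lemma balanced_of_winding_number_zero:
  fixes M :: "(complex \<times> complex) multiset"
  assumes E: "finite E" "\<And>S. S \<in> E \<Longrightarrow> closed S"
    and seg: "\<And>c d. (c, d) \<in># M \<Longrightarrow> closed_segment c d \<in> E"
    and wn: "\<And>p. p \<notin> \<Union>E \<Longrightarrow> (\<Sum>(c, d)\<in>#M. winding_number (linepath c d) p) = 0"
    and mid: "\<And>S. S \<in> E \<Longrightarrow> S \<noteq> closed_segment a b \<Longrightarrow> midpoint a b \<notin> S"
    and "a \<noteq> b"
  shows "count M (a, b) = count M (b, a)"
proof -
  define q where "q = midpoint a b"
  define h where "h = (b - a) / 2"
  have h: "h \<noteq> 0" using \<open>a \<noteq> b\<close> by (simp add: h_def)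
  have a: "a = q + (-1) * h" and b: "b = q + 1 * h"
    by (simp_all add: q_def h_def midpoint_def scaleR_conv_of_real field_simps)
  \<comment> \<open>In the coordinate \<open>w\<close> the corners are -1, 1 and
    \<open>\<i>\<close>: counterclockwise, with \<open>b c\<close> and \<open>c a\<close> away from
    \<open>q\<close>.\<close>
  define c where "c = q + \<i> * h"
  define R where "R = filter_mset (\<lambda>(c, d). {c, d} \<noteq> {a, b}) M"
  define d where "d = of_nat (count M (a, b)) - (of_nat (count M (b, a)) :: complex)"
  define tri where "tri = (\<lambda>p. winding_number (linepath a b) p + winding_number (linepath b c) p
                              + winding_number (linepath c a) p)"
  have M: "M = replicate_mset (count M (a, b)) (a, b) + replicate_mset (count M (b, a)) (b, a) + R"
    unfolding R_def by (rule multiset_eqI) (use \<open>a \<noteq> b\<close> in \<open>auto simp: doubleton_eq_iff\<close>)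
  have Rmid: "q \<notin> closed_segment u v" if "(u, v) \<in># R" for u v
    using that mid[OF seg[of u v]] by (auto simp: R_def q_def)
  define r where "r = (\<lambda>p. (\<Sum>(u, v)\<in>#R. winding_number (linepath u v) p))"
  have contR: "isCont r q"
  proof -
    have "\<forall>e\<in>#R. isCont (\<lambda>p. winding_number (linepath (fst e) (snd e)) p) q"
      using Rmid by (auto intro!: continuous_at_winding_number)
    then have "isCont (\<lambda>p. \<Sum>e\<in>#R. winding_number (linepath (fst e) (snd e)) p) q"
      by (induction R) auto
    then show ?thesis by (simp add: r_def case_prod_unfold)
  qed
  have ab: "Im w = 0" if "q + w * h \<in> closed_segment a b" for w
    using affine_in_closed_segmentD[OF that[unfolded a b] h] by (auto simp: in_segment)
  have bc: "Re w + Im w = 1" if "q + w * h \<in> closed_segment b c" for w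
    using affine_in_closed_segmentD[OF that[unfolded b c_def] h] by (auto simp: in_segment)
  have ca: "- Re w + Im w = 1" if "q + w * h \<in> closed_segment c a" for w
    using affine_in_closed_segmentD[OF that[unfolded a c_def] h] by (auto simp: in_segment)
  \<comment> \<open>Off \<open>E\<close> the sum over \<open>M\<close> vanishes, which gives
    \<open>f = - d * tri\<close>. Unlike \<open>tri\<close>, \<open>f\<close> only involves segments
    that miss \<open>q\<close>, so it is continuous there.\<close>
  define f where "f = (\<lambda>p. r p - d * (winding_number (linepath b c) p + winding_number (linepath c a) p))"
  have contf: "isCont f q"
    unfolding f_def using bc[of 0] ca[of 0]
    by (intro continuous_intros contR continuous_at_winding_number) auto
  have ev_E: "\<forall>\<^sub>F p in nhds q. \<forall>S\<in>E - {closed_segment a b}. p \<notin> S"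
  proof -
    have "open (- \<Union>(E - {closed_segment a b}))"
      using E by (intro open_Compl closed_Union) auto
    moreover have "q \<in> - \<Union>(E - {closed_segment a b})"
      using mid by (auto simp: q_def)
    ultimately have "\<forall>\<^sub>F p in nhds q. p \<in> - \<Union>(E - {closed_segment a b})"
      by (rule eventually_nhds_in_open)
    then show ?thesis by eventually_elim auto
  qed
  have ftri: "f p = - d * tri p"
    if "\<forall>S\<in>E - {closed_segment a b}. p \<notin> S" and pab: "p \<notin> closed_segment a b" for p
  proof -
    have "p \<notin> \<Union>E" using that by blast
    then have "(\<Sum>(u, v)\<in>#M. winding_number (linepath u v) p) = 0" by (rule wn)
    moreover have "winding_number (linepath b a) p = - winding_number (linepath a b) p"
      using winding_number_reversepath[of "linepath a b" p] pab by simp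
    ultimately show ?thesis
      unfolding f_def r_def tri_def d_def
      by (subst (asm) M) (simp add: algebra_simps)
  qed
  \<comment> \<open>The choices \<open>x = -1\<close> and \<open>x = 1\<close> approach
    \<open>q\<close> from the two sides of \<open>a b\<close>; continuity of \<open>f\<close> forces
    equal limits.\<close>
  have limf: "((\<lambda>t. - d * tri (q + (\<i> * of_real (x * t)) * h)) \<longlongrightarrow> f q) (at_right 0)" if "x \<noteq> 0" for x
  proof -
    have lim: "((\<lambda>t. q + (\<i> * of_real (x * t)) * h) \<longlongrightarrow> q) (at_right 0)"
      by (auto intro!: tendsto_eq_intros)
    have "\<forall>\<^sub>F t in at_right 0. f (q + (\<i> * of_real (x * t)) * h) = - d * tri (q + (\<i> * of_real (x * t)) * h)"
      using lim[unfolded filterlim_iff, rule_format, OF ev_E] eventually_at_right_less[of 0]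
    proof eventually_elim
      case (elim t)
      then show ?case using ab[of "\<i> * of_real (x * t)"] \<open>x \<noteq> 0\<close> by (intro ftri) auto
    qed
    with isCont_tendsto_compose[OF contf lim] show ?thesis
      by (rule Lim_transform_eventually)
  qed
  define \<gamma> where "\<gamma> = linepath a b +++ linepath b c +++ linepath c a"
  have tri: "tri p = winding_number \<gamma> p"
    if "p \<notin> closed_segment a b" "p \<notin> closed_segment b c" "p \<notin> closed_segment c a" for p
    unfolding tri_def \<gamma>_def using that
    by (simp add: winding_number_join path_image_join)
  have off: "q + (\<i> * of_real t) * h \<notin> closed_segment a b"
       "q + (\<i> * of_real t) * h \<notin> closed_segment b c"
       "q + (\<i> * of_real t) * h \<notin> closed_segment c a" if "t \<noteq> 0" "t < 1" for t
    using that ab[of "\<i> * of_real t"] bc[of "\<i> * of_real t"] ca[of "\<i> * of_real t"] by auto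
  have front: "frontier (convex hull {a, b, c}) = closed_segment a b \<union> closed_segment b c \<union> closed_segment c a"
    by (rule frontier_of_triangle) simp
  have hull: "q + (\<i> * of_real t) * h \<in> convex hull {a, b, c} \<longleftrightarrow> \<i> * of_real t \<in> convex hull {-1, 1, \<i>}" for t
    unfolding a b c_def by (rule affine_in_convex_hull_iff[OF h])
  have outside: "tri (q + (\<i> * of_real (-1 * t)) * h) = 0" if "0 < t" for t
  proof -
    have "\<i> * of_real (- t) \<notin> convex hull {-1, 1, \<i>}"
      using that by (auto simp: convex_hull_3 complex_eq_iff)
    then have "q + (\<i> * of_real (- t)) * h \<notin> convex hull {a, b, c}" by (simp only: hull not_False_eq_True)
    moreover have "path_image \<gamma> \<subseteq> convex hull {a, b, c}"
    proof -
      have "path_image \<gamma> = frontier (convex hull {a, b, c})"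
        by (simp add: \<gamma>_def path_image_join front Un_assoc)
      then show ?thesis
        by (simp add: frontier_subset_compact finite_imp_compact_convex_hull)
    qed
    ultimately have "winding_number \<gamma> (q + (\<i> * of_real (- t)) * h) = 0"
      by (intro winding_number_zero_outside[where s = "convex hull {a, b, c}"]) (auto simp: \<gamma>_def)
    then show ?thesis
      using tri[OF off[of "- t"]] that by simp
  qed
  have "\<forall>\<^sub>F t in at_right 0. - d * tri (q + (\<i> * of_real (-1 * t)) * h) = 0"
    using eventually_at_right_less[of 0] by eventually_elim (simp only: outside mult_zero_right)
  then have "((\<lambda>t. - d * tri (q + (\<i> * of_real (-1 * t)) * h)) \<longlongrightarrow> 0) (at_right 0)"
    by (rule tendsto_eventually)
  then have "f q = 0"
    using tendsto_unique[OF trivial_limit_at_right_real limf[of "-1"]] by simp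
  have inside: "tri (q + (\<i> * of_real (1 * t)) * h) = 1" if t: "0 < t" "t < 1" for t
  proof -
    define p where "p = q + (\<i> * of_real t) * h"
    have "\<i> * of_real t = ((1 - t) / 2) *\<^sub>R (-1) + ((1 - t) / 2) *\<^sub>R 1 + t *\<^sub>R \<i>"
      by (simp add: complex_eq_iff)
    then have "\<i> * of_real t \<in> convex hull {-1, 1, \<i>}"
      unfolding convex_hull_3 using t
      by (intro CollectI exI[of _ "(1 - t) / 2"] exI[of _ t]) (auto simp: field_simps)
    then have "p \<in> convex hull {a, b, c}" by (simp add: hull p_def)
    moreover have "p \<notin> frontier (convex hull {a, b, c})"
      using off[of t] t by (simp add: front p_def)
    ultimately have "p \<in> interior (convex hull {a, b, c})"
      using closure_subset by (auto simp: frontier_def)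
    \<comment> \<open>The sign of the imaginary part of this product decides the orientation in
      \<open>winding_number_triangle\<close>.\<close>
    moreover have "(b - a) * cnj (b - p) = of_real (2 * (cmod h)\<^sup>2) * (1 + \<i> * of_real t)"
    proof -
      have "b - p = h * (1 - \<i> * of_real t)" by (simp add: b p_def algebra_simps)
      then have "(b - a) * cnj (b - p) = 2 * (h * cnj h) * (1 + \<i> * of_real t)"
        by (simp add: a b)
      then show ?thesis by (simp flip: complex_norm_square)
    qed
    then have "0 < Im ((b - a) * cnj (b - p))"
      using t h by simp
    ultimately have "winding_number \<gamma> p = 1"
      unfolding \<gamma>_def by (simp add: winding_number_triangle)
    then show ?thesis using tri[of p] off[of t] t by (simp add: p_def)
  qed
  have "\<forall>\<^sub>F t in at_right 0. - d * tri (q + (\<i> * of_real (1 * t)) * h) = - d"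
    using eventually_at_right_real[OF zero_less_one]
    by eventually_elim (simp only: inside mult_1_right greaterThanLessThan_iff)
  then have "((\<lambda>t. - d * tri (q + (\<i> * of_real (1 * t)) * h)) \<longlongrightarrow> - d) (at_right 0)"
    by (rule tendsto_eventually)
  then have "f q = - d"
    using tendsto_unique[OF trivial_limit_at_right_real limf[of 1]] by simp
  with \<open>f q = 0\<close> have "d = 0" by simp
  then show ?thesis unfolding d_def by simp
qed

section \<open>Winding numbers of polygons\<close>

lemma polygonal_path_linepaths:
  assumes "2 \<le> length vs"
  shows pathstart_polygonal_path: "pathstart (polygonal_path vs) = hd vs"
    and pathfinish_polygonal_path: "pathfinish (polygonal_path vs) = last vs"
    and path_image_polygonal_path:
      "path_image (polygonal_path vs) = (\<Union>j<length vs - 1. closed_segment (vs ! j) (vs ! Suc j))"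
    and winding_number_polygonal_path: "p \<notin> path_image (polygonal_path vs) \<Longrightarrow>
      winding_number (polygonal_path vs) p
        = (\<Sum>j<length vs - 1. winding_number (linepath (vs ! j) (vs ! Suc j)) p)"
proof -
  have "path (polygonal_path vs) \<and> pathstart (polygonal_path vs) = hd vs \<and>
     pathfinish (polygonal_path vs) = last vs \<and>
     path_image (polygonal_path vs) = (\<Union>j<length vs - 1. closed_segment (vs ! j) (vs ! Suc j)) \<and>
     (p \<notin> path_image (polygonal_path vs) \<longrightarrow>
      winding_number (polygonal_path vs) p
        = (\<Sum>j<length vs - 1. winding_number (linepath (vs ! j) (vs ! Suc j)) p))"
    using assms
  proof (induction vs rule: polygonal_path.induct)
    case (4 a b c vs)
    then have IH: "path (polygonal_path (b # c # vs))" "pathstart (polygonal_path (b # c # vs)) = b"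
     "pathfinish (polygonal_path (b # c # vs)) = last (b # c # vs)"
     "path_image (polygonal_path (b # c # vs))
       = (\<Union>j<Suc (length vs). closed_segment ((b # c # vs) ! j) ((b # c # vs) ! Suc j))"
     "p \<notin> path_image (polygonal_path (b # c # vs)) \<Longrightarrow> winding_number (polygonal_path (b # c # vs)) p
        = (\<Sum>j<Suc (length vs). winding_number (linepath ((b # c # vs) ! j) ((b # c # vs) ! Suc j)) p)"
      by auto
    have "path_image (polygonal_path (a # b # c # vs))
       = closed_segment a b \<union> path_image (polygonal_path (b # c # vs))"
      using IH(2) by (simp add: path_image_join)
    moreover have "(\<Union>j<Suc (Suc (length vs)). closed_segment ((a # b # c # vs) ! j) ((a # b # c # vs) ! Suc j))
       = closed_segment a b \<union> (\<Union>j<Suc (length vs). closed_segment ((b # c # vs) ! j) ((b # c # vs) ! Suc j))"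
      by (subst lessThan_Suc_eq_insert_0) (simp del: nth_Cons_Suc add: nth_Cons_Suc[of a "b # c # vs"])
    moreover have "(\<Sum>j<Suc (Suc (length vs)). winding_number (linepath ((a # b # c # vs) ! j) ((a # b # c # vs) ! Suc j)) p)
       = winding_number (linepath a b) p
         + (\<Sum>j<Suc (length vs). winding_number (linepath ((b # c # vs) ! j) ((b # c # vs) ! Suc j)) p)"
      by (subst sum.lessThan_Suc_shift) simp
    moreover have "winding_number (polygonal_path (a # b # c # vs)) p
       = winding_number (linepath a b) p + winding_number (polygonal_path (b # c # vs)) p"
      if "p \<notin> closed_segment a b" "p \<notin> path_image (polygonal_path (b # c # vs))"
      using that IH(1,2) by (simp add: winding_number_join)
    ultimately show ?case using IH by (simp del: nth_Cons_Suc)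
  qed auto
  then show "pathstart (polygonal_path vs) = hd vs"
    "pathfinish (polygonal_path vs) = last vs"
    "path_image (polygonal_path vs) = (\<Union>j<length vs - 1. closed_segment (vs ! j) (vs ! Suc j))"
    "p \<notin> path_image (polygonal_path vs) \<Longrightarrow>
      winding_number (polygonal_path vs) p
        = (\<Sum>j<length vs - 1. winding_number (linepath (vs ! j) (vs ! Suc j)) p)"
    by auto
qed

lemma nth_append_hd:
  assumes "j < length vs"
  shows "(vs @ [hd vs]) ! j = vs ! j" "(vs @ [hd vs]) ! Suc j = vs ! (Suc j mod length vs)"
proof -
  have "vs \<noteq> []" using assms by auto
  then show "(vs @ [hd vs]) ! Suc j = vs ! (Suc j mod length vs)"
    using assms by (cases "Suc j = length vs") (auto simp: nth_append hd_conv_nth)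
qed (use assms in \<open>simp add: nth_append\<close>)

lemma polygon_path_linepaths:
  assumes "vs \<noteq> []"
  shows closed_polygon_path: "pathfinish (polygon_path vs) = pathstart (polygon_path vs)"
    and polygon_boundary_eq:
      "polygon_boundary vs = (\<Union>j<length vs. closed_segment (vs ! j) (vs ! (Suc j mod length vs)))"
    and winding_number_polygon_path: "p \<notin> polygon_boundary vs \<Longrightarrow>
      winding_number (polygon_path vs) p
        = (\<Sum>j<length vs. winding_number (linepath (vs ! j) (vs ! (Suc j mod length vs))) p)"
proof -
  have len: "2 \<le> length (vs @ [hd vs])" using assms by (simp add: Suc_le_eq)
  show "pathfinish (polygon_path vs) = pathstart (polygon_path vs)"
    "polygon_boundary vs = (\<Union>j<length vs. closed_segment (vs ! j) (vs ! (Suc j mod length vs)))"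
    unfolding polygon_path_def
    using assms pathstart_polygonal_path[OF len]
      pathfinish_polygonal_path[OF len] path_image_polygonal_path[OF len]
    by (simp_all add: nth_append_hd)
  show "winding_number (polygon_path vs) p
        = (\<Sum>j<length vs. winding_number (linepath (vs ! j) (vs ! (Suc j mod length vs))) p)"
    if "p \<notin> polygon_boundary vs"
    using winding_number_polygonal_path[OF len] that unfolding polygon_path_def
    by (simp add: nth_append_hd)
qed

section \<open>Insides and outsides of simple polygons\<close>

lemma simple_polygonD:
  assumes "simple_polygon vs"
  shows "vs \<noteq> []" "simple_path (polygon_path vs)"
    "pathfinish (polygon_path vs) = pathstart (polygon_path vs)" "path (polygon_path vs)"
proof -
  show "vs \<noteq> []" "simple_path (polygon_path vs)" using assms by (auto simp: simple_polygon_def)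
  then show "pathfinish (polygon_path vs) = pathstart (polygon_path vs)" "path (polygon_path vs)"
    using closed_polygon_path simple_path_imp_path by auto
qed

text \<open>The component of \<open>x\<close> in \<open>- B\<close> is unbounded and avoids
  \<open>A\<close>, so it lies in the component of \<open>x\<close> in \<open>- A\<close>, which is
  then unbounded too.\<close>

lemma outside_subset_outside:
  assumes "A \<subseteq> inside B \<union> B"
  shows "outside B \<subseteq> outside A"
proof
  fix x assume x: "x \<in> outside B"
  have xB: "x \<notin> B" using x outside_no_overlap[of B] by blast
  have "connected_component_set (- B) x \<subseteq> outside B"
    using x by (auto simp: outside_same_component)
  then have "connected_component_set (- B) x \<subseteq> - A"
    using assms inside_Int_outside[of B] outside_no_overlap[of B] by blast
  then have "connected_component_set (- B) x \<subseteq> connected_component_set (- A) x"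
    using x xB by (intro connected_component_maximal connected_connected_component) auto
  moreover have "x \<notin> A"
    using x assms inside_Int_outside[of B] outside_no_overlap[of B] by blast
  ultimately show "x \<in> outside A"
    using x by (auto simp: outside dest: bounded_subset)
qed

text \<open>The inside of \<open>a\<close> is connected and misses the curve \<open>b\<close>, so it
  stays in one component of the complement of \<open>b\<close>, that of \<open>x\<close>.\<close>

lemma inside_subset_inside:
  fixes a b :: "real \<Rightarrow> complex"
  assumes "simple_path a" "pathfinish a = pathstart a"
    and "path_image b \<subseteq> outside (path_image a)"
    and "x \<in> inside (path_image a)" "x \<in> inside (path_image b)"
  shows "inside (path_image a) \<subseteq> inside (path_image b)"
proof
  fix w assume w: "w \<in> inside (path_image a)"
  have "connected (inside (path_image a))"
    using Jordan_inside_outside[OF assms(1,2)] by blast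
  moreover have "inside (path_image a) \<subseteq> - path_image b"
    using assms(3) inside_Int_outside by fastforce
  ultimately have "connected_component (- path_image b) x w"
    using w assms(4) unfolding connected_component_def by blast
  then show "w \<in> inside (path_image b)"
    using assms(5) by (metis inside_same_component)
qed

text \<open>A common point would make the insides equal, hence also their frontiers, which are the
  curves; but each curve lies outside the other.\<close>

lemma disjoint_inside:
  fixes a b :: "real \<Rightarrow> complex"
  assumes a: "simple_path a" "pathfinish a = pathstart a"
    and b: "simple_path b" "pathfinish b = pathstart b"
    and ab: "path_image a \<subseteq> outside (path_image b)" "path_image b \<subseteq> outside (path_image a)"
  shows "inside (path_image a) \<inter> inside (path_image b) = {}"
proof (rule ccontr)
  assume "\<not> ?thesis"
  then obtain x where "x \<in> inside (path_image a)" "x \<in> inside (path_image b)" by blast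
  then have "inside (path_image a) = inside (path_image b)"
    using inside_subset_inside[OF a ab(2)] inside_subset_inside[OF b ab(1)] by blast
  then have "path_image a = path_image b"
    using Jordan_inside_outside[OF a] Jordan_inside_outside[OF b] by metis
  then show False
    using ab(1) outside_no_overlap[of "path_image b"] path_image_nonempty[of b] by blast
qed

text \<open>Outside the outer polygon every term is 0. In the region only the outer polygon
  contributes, with 1. Inside a hole, the -1 of that hole cancels this 1 and the other holes
  contribute 0.\<close>

lemma sum_winding_number_holed_region:
  assumes H: "polygon_with_holes k H"
    and sub: "\<And>i. i \<le> k \<Longrightarrow> polygon_boundary (H i) \<subseteq> holed_region k H"
    and p: "\<And>i. i \<le> k \<Longrightarrow> p \<notin> polygon_boundary (H i)"
  shows "(\<Sum>i\<le>k. winding_number (polygon_path (H i)) p) = (if p \<in> holed_region k H then 1 else 0)"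
proof -
  let ?w = "\<lambda>i. winding_number (polygon_path (H i)) p"
  have simple: "simple_polygon (H i)" if "i \<le> k" for i
    using H that by (simp add: polygon_with_holes_def)
  note J = simple_polygonD[OF simple]
  have out: "?w i = 0" if "i \<le> k" "p \<in> outside (polygon_boundary (H i))" for i
    using winding_number_zero_in_outside J[OF that(1)] that by blast
  have io: "p \<in> inside (polygon_boundary (H i)) \<or> p \<in> outside (polygon_boundary (H i))" if "i \<le> k" for i
    using p[OF that] inside_Un_outside[of "polygon_boundary (H i)"] by blast
  have split: "(\<Sum>i\<le>k. ?w i) = ?w 0 + (\<Sum>i\<in>{1..k}. ?w i)"
    by (simp add: sum.atMost_shift atLeast0AtMost[symmetric] sum.atLeast_Suc_atMost)
  have holes: "polygon_boundary (H i) \<subseteq> inside (polygon_boundary (H 0))" if "i \<in> {1..k}" for i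
    using H that by (simp add: polygon_with_holes_def)
  consider "p \<in> outside (polygon_boundary (H 0))"
    | "p \<in> inside (polygon_boundary (H 0))" "\<And>i. i \<in> {1..k} \<Longrightarrow> p \<in> outside (polygon_boundary (H i))"
    | m where "p \<in> inside (polygon_boundary (H 0))" "m \<in> {1..k}" "p \<in> inside (polygon_boundary (H m))"
    using io by (metis atLeastAtMost_iff le0)
  then show ?thesis
  proof cases
    case 1
    have "?w i = 0" if "i \<le> k" for i
    proof (cases "i = 0")
      case True
      then show ?thesis using 1 out by simp
    next
      case False
      then have "outside (polygon_boundary (H 0)) \<subseteq> outside (polygon_boundary (H i))"
        using holes[of i] that by (intro outside_subset_outside) auto
      then show ?thesis using 1 out that by blast
    qed
    moreover have "p \<notin> holed_region k H"
    proof -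
      have "p \<notin> polygon_boundary (H 0) \<union> inside (polygon_boundary (H 0))"
        using 1 p[of 0] inside_Int_outside[of "polygon_boundary (H 0)"] by blast
      then show ?thesis unfolding holed_region_def by (rule contrapos_nn) (rule IntD1)
    qed
    ultimately show ?thesis by simp
  next
    case 2
    then have "?w 0 = 1" using H by (simp add: polygon_with_holes_def counterclockwise_def)
    moreover have "p \<in> holed_region k H" using 2 by (auto simp: holed_region_def)
    ultimately show ?thesis using split 2(2) out by simp
  next
    case 3
    then have "?w 0 = 1" "?w m = - 1"
      using H by (auto simp: polygon_with_holes_def counterclockwise_def clockwise_def)
    moreover have "?w i = 0" if "i \<in> {1..k} - {m}" for i
    proof -
      \<comment> \<open>Nesting of holes is excluded here: a boundary lying in the region is on or
        outside every other hole, and disjointness leaves only outside.\<close>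
      have outs: "polygon_boundary (H i) \<subseteq> outside (polygon_boundary (H j))"
        if "i \<in> {1..k}" "j \<in> {1..k}" "i \<noteq> j" for i j
      proof -
        have "polygon_boundary (H i) \<inter> polygon_boundary (H j) = {}"
          using H that by (auto simp: polygon_with_holes_def)
        then show ?thesis
          using sub[of i] that by (fastforce simp: holed_region_def)
      qed
      have "inside (polygon_boundary (H i)) \<inter> inside (polygon_boundary (H m)) = {}"
        using that 3(2) J[of i] J[of m] by (intro disjoint_inside outs) auto
      then show ?thesis using 3(3) io[of i] out[of i] that by auto
    qed
    then have "(\<Sum>i\<in>{1..k}. ?w i) = ?w m"
      using 3(2) by (subst sum.remove[of _ m]) auto
    moreover have "p \<notin> holed_region k H"
    proof -
      have "m \<le> k" using 3(2) by simp
      then have "p \<notin> polygon_boundary (H m) \<union> outside (polygon_boundary (H m))"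
        using 3(3) p[of m] \<open>m \<le> k\<close> inside_Int_outside[of "polygon_boundary (H m)"] by blast
      then show ?thesis unfolding holed_region_def using 3(2) by blast
    qed
    ultimately show ?thesis using split by simp
  qed
qed

section \<open>The boundary of a triangulation\<close>

lemma sum_mset_image_sum:
  "finite A \<Longrightarrow> (\<Sum>x\<in>#(\<Sum>i\<in>A. N i). f x) = (\<Sum>i\<in>A. \<Sum>x\<in>#N i. f x)"
  by (induction A rule: finite_induct) auto

section \<open>Orientation of triangles\<close>

lemma frontier_triangle:
  fixes a b c :: complex
  shows "frontier (convex hull {a, b, c}) = closed_segment a b \<union> closed_segment b c \<union> closed_segment c a"
  by (rule frontier_of_triangle) simp

text \<open>Off the sides, the sum is the winding number of a closed path: it vanishes off the hull
  and is constant on the connected interior, where the orientation makes it 1 or -1.\<close>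

lemma winding_number_triangle_sides:
  obtains s where "s \<in> {1, - 1}"
    "\<And>p. p \<notin> closed_segment a b \<union> closed_segment b c \<union> closed_segment c a \<Longrightarrow>
       winding_number (linepath a b) p + winding_number (linepath b c) p + winding_number (linepath c a) p
         = (if p \<in> convex hull {a, b, c} then s else 0)"
proof -
  define \<gamma> where "\<gamma> = linepath a b +++ linepath b c +++ linepath c a"
  let ?K = "convex hull {a, b, c}"
  have \<gamma>: "path \<gamma>" "pathfinish \<gamma> = pathstart \<gamma>" "path_image \<gamma> = frontier ?K"
    by (simp_all add: \<gamma>_def path_image_join frontier_triangle Un_assoc)
  have "winding_number \<gamma> constant_on interior ?K"
    using \<gamma> by (intro winding_number_constant convex_connected) (auto simp: frontier_def)
  then obtain s where s: "\<And>p. p \<in> interior ?K \<Longrightarrow> winding_number \<gamma> p = s"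
    by (auto simp: constant_on_def)
  \<comment> \<open>A flat triangle has empty interior, so no point off its sides lies in the hull
    and the default value 1 is consistent.\<close>
  define s' where "s' = (if interior ?K = {} then 1 else s)"
  have "s' \<in> {1, - 1}"
  proof (cases "interior ?K = {}")
    case False
    then obtain p where p: "p \<in> interior ?K" by blast
    then have "winding_number \<gamma> p \<in> {1, - 1}"
      unfolding \<gamma>_def by (subst winding_number_triangle) auto
    then show ?thesis using False s[OF p] by (simp add: s'_def)
  qed (simp add: s'_def)
  moreover have "winding_number (linepath a b) p + winding_number (linepath b c) p
      + winding_number (linepath c a) p = (if p \<in> ?K then s' else 0)"
    if p: "p \<notin> closed_segment a b \<union> closed_segment b c \<union> closed_segment c a" for p
  proof -
    have "winding_number \<gamma> p = winding_number (linepath a b) p + winding_number (linepath b c) p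
      + winding_number (linepath c a) p"
      unfolding \<gamma>_def using p by (simp add: winding_number_join path_image_join)
    moreover have "winding_number \<gamma> p = s'" if "p \<in> ?K"
    proof -
      have "p \<in> interior ?K"
        using that p closure_subset by (auto simp: frontier_def frontier_triangle[symmetric])
      then show ?thesis using s by (auto simp: s'_def)
    qed
    moreover have "winding_number \<gamma> p = 0" if "p \<notin> ?K"
      using that \<gamma> by (intro winding_number_zero_outside[where s = ?K])
        (auto simp: frontier_subset_compact finite_imp_compact_convex_hull)
    ultimately show ?thesis by simp
  qed
  ultimately show thesis using that by blast
qed

text \<open>Exchanging two corners reverses all three sides and flips the sign in
  \<open>winding_number_triangle_sides\<close>, so one of the orders \<open>a, b, c\<close> and
  \<open>b, a, c\<close> has sign 1.\<close>

lemma counterclockwise_triangle: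
  assumes "2 simplex S"
  obtains a b c :: complex where "S = convex hull {a, b, c}" "\<not> affine_dependent {a, b, c}"
    "\<And>p. p \<notin> closed_segment a b \<union> closed_segment b c \<union> closed_segment c a \<Longrightarrow>
       winding_number (linepath a b) p + winding_number (linepath b c) p + winding_number (linepath c a) p
         = (if p \<in> S then 1 else 0)"
proof -
  obtain C where C: "\<not> affine_dependent C" "card C = 3" "S = convex hull C"
    using assms by (auto simp: simplex_def)
  then obtain a b c where abc: "C = {a, b, c}" by (auto simp: card_3_iff)
  obtain s where s: "s \<in> {1, - 1}"
    "\<And>p. p \<notin> closed_segment a b \<union> closed_segment b c \<union> closed_segment c a \<Longrightarrow>
       winding_number (linepath a b) p + winding_number (linepath b c) p + winding_number (linepath c a) p
         = (if p \<in> S then s else 0)"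
    using winding_number_triangle_sides[of a b c] C(3) abc by metis
  show thesis
  proof (cases "s = 1")
    case True
    then show thesis using that[of a b c] s C abc by blast
  next
    case False
    then have "s = - 1" using s by auto
    have rev: "winding_number (linepath v u) p = - winding_number (linepath u v) p"
      if "p \<notin> closed_segment u v" for u v p
      using winding_number_reversepath[of "linepath u v" p] that by simp
    have "winding_number (linepath b a) p + winding_number (linepath a c) p + winding_number (linepath c b) p
         = (if p \<in> S then 1 else 0)"
      if "p \<notin> closed_segment b a \<union> closed_segment a c \<union> closed_segment c b" for p
    proof -
      have "p \<notin> closed_segment a b" "p \<notin> closed_segment b c" "p \<notin> closed_segment c a"
        using that by (auto simp: closed_segment_commute)
      then have eq: "winding_number (linepath b a) p + winding_number (linepath a c) p
          + winding_number (linepath c b) p = - (winding_number (linepath a b) p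
            + winding_number (linepath b c) p + winding_number (linepath c a) p)"
        and off: "p \<notin> closed_segment a b \<union> closed_segment b c \<union> closed_segment c a"
        using rev[of p a b] rev[of p b c] rev[of p c a] by auto
      show ?thesis unfolding eq s(2)[OF off] using \<open>s = - 1\<close> by simp
    qed
    then show thesis using that[of b a c] C abc by (simp add: insert_commute)
  qed
qed

section \<open>How simplices of a complex meet\<close>

lemma simplicial_complexD:
  assumes "simplicial_complex T"
  shows "finite T" "\<And>S. S \<in> T \<Longrightarrow> \<exists>n. n simplex S"
    "\<And>F S. S \<in> T \<Longrightarrow> F face_of S \<Longrightarrow> F \<in> T"
    "\<And>S S'. S \<in> T \<Longrightarrow> S' \<in> T \<Longrightarrow> S \<inter> S' face_of S"
  using assms by (auto simp: simplicial_complex_def)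

lemma aff_dim_segment: "a \<noteq> b \<Longrightarrow> aff_dim (closed_segment a b) = 1"
  using aff_dim_simplex one_simplex_segment by blast

text \<open>This supplies the midpoint condition of \<open>balanced_of_winding_number_zero\<close>.
  The midpoint is relatively interior to the segment, so the common face would be the whole segment
  and a proper face of \<open>S\<close>, against the dimension bound.\<close>

lemma simplicial_complex_midpoint:
  assumes T: "simplicial_complex T" and "closed_segment a b \<in> T" "S \<in> T"
    and "a \<noteq> b" "aff_dim S \<le> 1" "S \<noteq> closed_segment a b"
  shows "midpoint a b \<notin> S"
proof
  assume "midpoint a b \<in> S"
  let ?X = "closed_segment a b"
  note D = simplicial_complexD[OF T]
  have "midpoint a b \<in> rel_interior ?X"
    using \<open>a \<noteq> b\<close> by (simp add: rel_interior_closed_segment midpoint_in_open_segment)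
  then have "midpoint a b \<in> (?X \<inter> S) \<inter> rel_interior ?X"
    using \<open>midpoint a b \<in> S\<close> by auto
  then have "?X \<subseteq> ?X \<inter> S"
    using subset_of_face_of[OF D(4)[of ?X S]] assms by blast
  then have "?X face_of S"
    using D(4)[of S ?X] assms by (metis Int_absorb1 Int_subset_iff)
  then have "aff_dim ?X < aff_dim S"
    using face_of_aff_dim_lt[of S ?X] D(2)[OF \<open>S \<in> T\<close>] convex_simplex assms by blast
  then show False using aff_dim_segment[OF \<open>a \<noteq> b\<close>] assms by simp
qed

text \<open>The common face of \<open>S\<close> and \<open>S'\<close> contains an interior point of
  each, so it is all of each.\<close>

lemma simplicial_complex_unique_triangle:
  assumes T: "simplicial_complex T" and S: "S \<in> T" "S' \<in> T" and p: "p \<in> interior S" "p \<in> interior S'"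
  shows "S = S'"
proof -
  have "S \<subseteq> S'" if "S \<in> T" "S' \<in> T" "p \<in> interior S" "p \<in> interior S'" for S S'
  proof -
    have "p \<in> S \<inter> S' \<inter> rel_interior S"
      using that interior_subset interior_subset_rel_interior by blast
    then show ?thesis
      using subset_of_face_of[OF simplicial_complexD(4)[OF T that(1,2)], of S] by blast
  qed
  then show ?thesis using assms by blast
qed

text \<open>A discrete Stokes formula: antisymmetric edge weights summed around all triangles reduce
  to the boundary. The cancellation along inner edges comes from winding numbers, not from counting
  the triangles at an edge.\<close>

lemma triangulation_boundary_chain:
  assumes H: "polygon_with_holes k H" and T: "triangulates T k H"
  obtains A B C :: "complex set \<Rightarrow> complex" where
    "\<And>S. S \<in> triangles T \<Longrightarrow> S = convex hull {A S, B S, C S} \<and> \<not> affine_dependent {A S, B S, C S}"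
    "\<And>g :: complex \<Rightarrow> complex \<Rightarrow> real. (\<And>a b. g b a = - g a b) \<Longrightarrow>
       (\<Sum>S\<in>triangles T. g (A S) (B S) + g (B S) (C S) + g (C S) (A S))
         = (\<Sum>i\<le>k. \<Sum>j<length (H i). g (H i ! j) (H i ! (Suc j mod length (H i))))"
proof -
  have sc: "simplicial_complex T" and UT: "\<Union>T = holed_region k H"
    and edges: "\<And>i. i \<le> k \<Longrightarrow> polygon_edges (H i) \<subseteq> T"
    using T by (auto simp: triangulates_def)
  note D = simplicial_complexD[OF sc]
  have fin: "finite (triangles T)" using D(1) by (simp add: triangles_def)
  define pos where "pos S a b c \<longleftrightarrow> S = convex hull {a, b, c} \<and> \<not> affine_dependent {a, b, c} \<and>
     (\<forall>p. p \<notin> closed_segment a b \<union> closed_segment b c \<union> closed_segment c a \<longrightarrow>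
       winding_number (linepath a b) p + winding_number (linepath b c) p + winding_number (linepath c a) p
         = (if p \<in> S then 1 else 0))" for S a b c
  have "\<exists>a b c. pos S a b c" if "S \<in> triangles T" for S
  proof -
    have "2 simplex S" using that by (simp add: triangles_def)
    then show ?thesis
      by (rule counterclockwise_triangle) (unfold pos_def, blast)
  qed
  then obtain A B C where ABC': "\<And>S. S \<in> triangles T \<Longrightarrow> pos S (A S) (B S) (C S)" by metis
  then have ABC: "\<And>S. S \<in> triangles T \<Longrightarrow> S = convex hull {A S, B S, C S}"
    "\<And>S. S \<in> triangles T \<Longrightarrow> \<not> affine_dependent {A S, B S, C S}"
    and wnT: "\<And>S p. S \<in> triangles T \<Longrightarrow>
       p \<notin> closed_segment (A S) (B S) \<union> closed_segment (B S) (C S) \<union> closed_segment (C S) (A S) \<Longrightarrow>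
       winding_number (linepath (A S) (B S)) p + winding_number (linepath (B S) (C S)) p
         + winding_number (linepath (C S) (A S)) p = (if p \<in> S then 1 else 0)"
    unfolding pos_def by blast+
  define nxt where "nxt = (\<lambda>i j. H i ! (Suc j mod length (H i)))"
  \<comment> \<open>Boundary edges enter reversed, so the formula amounts to \<open>M\<close> being
    balanced.\<close>
  define M where "M = (\<Sum>S\<in>triangles T. {#(A S, B S), (B S, C S), (C S, A S)#})
    + (\<Sum>i\<le>k. image_mset (\<lambda>j. (nxt i j, H i ! j)) (mset_set {..<length (H i)}))"
  \<comment> \<open>The value type stays open: the formula is used for complex winding numbers and
    for the real weight \<open>g\<close>.\<close>
  have sum_M: "(\<Sum>(c, d)\<in>#M. f c d) = (\<Sum>S\<in>triangles T. f (A S) (B S) + f (B S) (C S) + f (C S) (A S))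
     + (\<Sum>i\<le>k. \<Sum>j<length (H i). f (nxt i j) (H i ! j))"
    for f :: "complex \<Rightarrow> complex \<Rightarrow> 'r :: comm_monoid_add"
    by (simp add: M_def sum_mset_image_sum fin image_mset.compositionality o_def add.assoc flip: sum_unfold_sum_mset)
  have in_M: "(\<exists>S\<in>triangles T. (c, d) \<in> {(A S, B S), (B S, C S), (C S, A S)}) \<or>
      (\<exists>i\<le>k. \<exists>j<length (H i). c = nxt i j \<and> d = H i ! j)" if "(c, d) \<in># M" for c d
    using that by (auto simp: M_def set_mset_sum fin)
  define E where "E = {S \<in> T. aff_dim S \<le> 1}"
  have E: "finite E" "\<And>S. S \<in> E \<Longrightarrow> closed S"
    using D(1,2) closed_simplex by (auto simp: E_def)
  have seg_E: "closed_segment a b \<in> E" if "closed_segment a b \<in> T" for a b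
    using that aff_dim_segment[of a b] by (cases "a = b") (auto simp: E_def)
  have HE: "closed_segment (H i ! j) (nxt i j) \<in> E" if "i \<le> k" "j < length (H i)" for i j
    using edges[OF that(1)] that by (intro seg_E) (auto simp: polygon_edges_def nxt_def)
  have TE: "closed_segment u v \<in> E" if "S \<in> triangles T" "{u, v} \<subseteq> {A S, B S, C S}" for u v S
  proof -
    have "closed_segment u v face_of S"
      unfolding segment_convex_hull
      using that ABC by (metis face_of_convex_hull_affine_independent)
    then show ?thesis using that D(3) by (intro seg_E) (auto simp: triangles_def)
  qed
  have seg: "closed_segment c d \<in> E" if "(c, d) \<in># M" for c d
    using in_M[OF that] HE TE by (auto simp: closed_segment_commute)
  have bd: "polygon_boundary (H i) = (\<Union>j<length (H i). closed_segment (H i ! j) (nxt i j))"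
    and wnH: "p \<notin> polygon_boundary (H i) \<Longrightarrow> winding_number (polygon_path (H i)) p
        = (\<Sum>j<length (H i). winding_number (linepath (H i ! j) (nxt i j)) p)" if "i \<le> k" for i p
    using H that polygon_boundary_eq[of "H i"] winding_number_polygon_path[of "H i" p]
    by (auto simp: polygon_with_holes_def simple_polygonD nxt_def)
  have sub: "polygon_boundary (H i) \<subseteq> holed_region k H" if "i \<le> k" for i
    unfolding UT[symmetric] bd[OF that] using HE[OF that] by (auto simp: E_def)
  have wn: "(\<Sum>(c, d)\<in>#M. winding_number (linepath c d) p) = 0" if p: "p \<notin> \<Union>E" for p
  proof -
    have off: "p \<notin> closed_segment (A S) (B S) \<union> closed_segment (B S) (C S) \<union> closed_segment (C S) (A S)"
      if "S \<in> triangles T" for S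
      using p TE[OF that, of "A S" "B S"] TE[OF that, of "B S" "C S"] TE[OF that, of "C S" "A S"] by auto
    have int: "p \<in> interior S" if "S \<in> triangles T" "p \<in> S" for S
    proof -
      have "p \<notin> frontier S"
        using off[OF that(1)] ABC(1)[OF that(1)] frontier_triangle by metis
      then show ?thesis using that(2) closure_subset by (auto simp: frontier_def)
    qed
    have wn_S: "(\<Sum>S\<in>triangles T. winding_number (linepath (A S) (B S)) p
        + winding_number (linepath (B S) (C S)) p + winding_number (linepath (C S) (A S)) p)
      = (\<Sum>S\<in>triangles T. if p \<in> S then 1 else 0)"
      by (intro sum.cong refl wnT off)
    \<comment> \<open>A point of the region off the faces of dimension at most 1 lies in the
      interior of a triangle, and by uniqueness in no other triangle.\<close>
    have "(\<Sum>S\<in>triangles T. if p \<in> S then 1 else 0 :: complex) = (if p \<in> holed_region k H then 1 else 0)"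
    proof (cases "p \<in> holed_region k H")
      case True
      then obtain S n where S: "S \<in> T" "p \<in> S" "n simplex S" using UT D(2) by blast
      have "n = 2"
      proof -
        have "\<not> aff_dim S \<le> 1" using S p by (auto simp: E_def)
        then show ?thesis using aff_dim_simplex[OF S(3)] aff_dim_le_DIM[of S] by simp
      qed
      then have S': "S \<in> triangles T" using S by (simp add: triangles_def)
      have "(\<Sum>S'\<in>triangles T. if p \<in> S' then 1 else 0 :: complex)
          = (\<Sum>S'\<in>triangles T. if S' = S then 1 else 0)"
      proof (intro sum.cong refl)
        fix S' assume "S' \<in> triangles T"
        then have "p \<in> S' \<longleftrightarrow> S' = S"
          using simplicial_complex_unique_triangle[OF sc, of S' S p] int[of S'] int[OF S' S(2)] S
          by (auto simp: triangles_def)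
        then show "(if p \<in> S' then 1 else 0 :: complex) = (if S' = S then 1 else 0)" by simp
      qed
      then show ?thesis using True S' fin by simp
    next
      case False
      then have "\<forall>S\<in>triangles T. p \<notin> S" using UT by (auto simp: triangles_def)
      then show ?thesis using False by simp
    qed
    moreover have "p \<notin> polygon_boundary (H i)" if "i \<le> k" for i
      unfolding bd[OF that] using HE[OF that] p by blast
    moreover have "winding_number (linepath (nxt i j) (H i ! j)) p
        = - winding_number (linepath (H i ! j) (nxt i j)) p" if "i \<le> k" "j < length (H i)" for i j
      using winding_number_reversepath[of "linepath (H i ! j) (nxt i j)" p] HE[OF that] p by auto
    ultimately show ?thesis
      using sum_winding_number_holed_region[OF H sub, of p]
      by (simp add: sum_M wn_S wnH sum_negf)
  qed
  have bal: "count M (a, b) = count M (b, a)" if "a \<noteq> b" for a b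
  proof (cases "closed_segment a b \<in> E")
    case True
    show ?thesis
      using True that by (intro balanced_of_winding_number_zero[OF E seg wn] simplicial_complex_midpoint[OF sc])
        (auto simp: E_def)
  next
    case False
    then have "(a, b) \<notin># M" "(b, a) \<notin># M"
      using seg[of a b] seg[of b a] by (auto simp: closed_segment_commute)
    then show ?thesis by (simp add: not_in_iff)
  qed
  show thesis
  proof (rule that)
    show "S = convex hull {A S, B S, C S} \<and> \<not> affine_dependent {A S, B S, C S}"
      if "S \<in> triangles T" for S using ABC that by blast
  next
    fix g :: "complex \<Rightarrow> complex \<Rightarrow> real" assume anti: "\<And>a b. g b a = - g a b"
    have "(\<Sum>(c, d)\<in>#M. g c d) = 0"
      by (rule sum_mset_antisym_zero[OF bal anti])
    moreover have "(\<Sum>i\<le>k. \<Sum>j<length (H i). g (nxt i j) (H i ! j))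
        = - (\<Sum>i\<le>k. \<Sum>j<length (H i). g (H i ! j) (nxt i j))"
      unfolding sum_negf[symmetric] by (intro sum.cong refl anti)
    ultimately show "(\<Sum>S\<in>triangles T. g (A S) (B S) + g (B S) (C S) + g (C S) (A S))
         = (\<Sum>i\<le>k. \<Sum>j<length (H i). g (H i ! j) (H i ! (Suc j mod length (H i))))"
      by (simp add: sum_M nxt_def)
  qed
qed

section \<open>Crossings of a ray\<close>

text \<open>The ray is \<open>z + r d\<close> with \<open>r \<ge> 0\<close>. Points on its line count as lying on the left, so no
  general position is needed; a segment contained in the line has crossing number 0.\<close>

definition side :: "complex \<Rightarrow> complex \<Rightarrow> complex \<Rightarrow> bool" where
  "side z d p \<longleftrightarrow> 0 \<le> Im ((p - z) * cnj d)"

definition hits_ray :: "complex \<Rightarrow> complex \<Rightarrow> complex \<Rightarrow> complex \<Rightarrow> bool" where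
  "hits_ray z d a b \<longleftrightarrow> (\<exists>r\<ge>0. z + of_real r * d \<in> closed_segment a b)"

definition crossing :: "complex \<Rightarrow> complex \<Rightarrow> complex \<Rightarrow> complex \<Rightarrow> real" where
  "crossing z d a b = (if hits_ray z d a b then of_bool (side z d b) - of_bool (side z d a) else 0)"

lemma crossing_antisym: "crossing z d b a = - crossing z d a b"
proof -
  have "hits_ray z d b a = hits_ray z d a b"
    by (simp add: hits_ray_def closed_segment_commute)
  then show ?thesis by (simp add: crossing_def)
qed

lemma crossing_not_hits: "\<not> hits_ray z d a b \<Longrightarrow> crossing z d a b = 0"
  by (simp add: crossing_def)

lemma side_change_meets_line:
  assumes "d \<noteq> 0" "side z d a \<noteq> side z d b"
  obtains r where "z + of_real r * d \<in> closed_segment a b"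
proof -
  define u where "u = (\<lambda>p. Im ((p - z) * cnj d))"
  \<comment> \<open>The zero of the affine function \<open>u\<close> along the segment from
    \<open>a\<close> to \<open>b\<close>.\<close>
  define s where "s = u a / (u a - u b)"
  have side: "side z d p \<longleftrightarrow> 0 \<le> u p" for p
    by (simp only: side_def u_def)
  have ne: "u a - u b \<noteq> 0" and s: "0 \<le> s" "s \<le> 1"
    using assms(2) unfolding side by (auto simp: s_def divide_simps)
  define p where "p = (1 - s) *\<^sub>R a + s *\<^sub>R b"
  have "u p = (1 - s) * u a + s * u b"
    by (simp add: p_def u_def algebra_simps)
  also have "\<dots> = u a - s * (u a - u b)" by (simp add: algebra_simps)
  also have "\<dots> = 0" using ne by (simp add: s_def)
  finally have "Im ((p - z) * cnj d) = 0" by (simp add: u_def)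
  then obtain t where "(p - z) * cnj d = of_real t"
    by (metis complex_is_Real_iff Reals_cases)
  then have "(p - z) * cnj d * d = of_real t * d" by (rule arg_cong)
  then have "(p - z) * of_real ((cmod d)\<^sup>2) = of_real t * d"
    by (simp only: complex_norm_square mult.assoc mult.commute[of "cnj d" d])
  then have "p = z + of_real (t / (cmod d)\<^sup>2) * d"
    using \<open>d \<noteq> 0\<close> by (simp add: field_simps)
  moreover have "p \<in> closed_segment a b" using s by (auto simp: p_def in_segment)
  ultimately show thesis using that by metis
qed

lemma hull_of_opposite_crossings:
  fixes z d :: complex
  assumes "z + of_real r * d \<in> K" "0 \<le> r" "z + of_real r' * d \<in> K" "r' < 0" "convex K"
  shows "z \<in> K"
proof -
  \<comment> \<open>The weight at which the parameters \<open>r\<close> and \<open>r'\<close>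
    average to 0, the parameter of \<open>z\<close>.\<close>
  define s where "s = r / (r - r')"
  have "r - r' \<noteq> 0" using assms by simp
  then have s: "0 \<le> s" "s \<le> 1" "(1 - s) * r + s * r' = 0"
    using assms by (auto simp: s_def divide_simps algebra_simps)
  have "(1 - s) *\<^sub>R (z + of_real r * d) + s *\<^sub>R (z + of_real r' * d)
      = z + of_real ((1 - s) * r + s * r') * d"
    by (simp add: scaleR_conv_of_real algebra_simps)
  also have "\<dots> = z" using \<open>(1 - s) * r + s * r' = 0\<close> by simp
  finally show ?thesis
    using convexD_alt[OF assms(5,1,3) s(1,2)] by simp
qed

text \<open>The corner \<open>a\<close> is separated from \<open>b\<close> and \<open>c\<close>, so
  both sides at \<open>a\<close> meet the line. If both hit the ray, their crossing numbers are
  opposite; the sum is nonzero only if exactly one does.\<close>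

lemma crossing_two_sides:
  fixes z d a b c :: complex
  assumes "d \<noteq> 0" "side z d a \<noteq> side z d b" "side z d b = side z d c"
  defines "w \<equiv> crossing z d a b + crossing z d c a"
  shows "\<bar>w\<bar> \<le> 1" "w \<noteq> 0 \<Longrightarrow> z \<in> convex hull {a, b, c}"
proof -
  show "\<bar>w\<bar> \<le> 1"
    using assms(2,3) unfolding w_def crossing_def by auto
  have sub: "closed_segment a b \<subseteq> convex hull {a, b, c}" "closed_segment c a \<subseteq> convex hull {a, b, c}"
    by (auto simp: segment_convex_hull intro!: hull_mono)
  assume "w \<noteq> 0"
  then have "hits_ray z d a b \<noteq> hits_ray z d c a"
    using assms(2,3) unfolding w_def crossing_def by (auto split: if_splits)
  moreover obtain r where r: "z + of_real r * d \<in> closed_segment a b"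
    using side_change_meets_line[OF assms(1,2)] .
  moreover obtain r' where r': "z + of_real r' * d \<in> closed_segment c a"
    using side_change_meets_line[OF assms(1), of z c a] assms(2,3) by auto
  \<comment> \<open>The side that misses the ray still meets its line, necessarily at a negative
    parameter.\<close>
  ultimately obtain s s' where "0 \<le> s" "s' < 0"
    "z + of_real s * d \<in> convex hull {a, b, c}" "z + of_real s' * d \<in> convex hull {a, b, c}"
    using sub unfolding hits_ray_def by (meson linorder_not_less subsetD)
  then show "z \<in> convex hull {a, b, c}"
    by (intro hull_of_opposite_crossings[of z s d _ s']) auto
qed

text \<open>A triangle whose vertices are not all on one side has exactly two sides meeting the line. Their
  contributions cancel unless one meets the ray and the other the opposite ray, in which case \<open>z\<close>
  lies between the two meeting points.\<close>

lemma crossing_triangle: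
  fixes z d a b c :: complex
  assumes "d \<noteq> 0"
  defines "w \<equiv> crossing z d a b + crossing z d b c + crossing z d c a"
  shows "\<bar>w\<bar> \<le> 1" "w \<noteq> 0 \<Longrightarrow> z \<in> convex hull {a, b, c} \<and> a \<noteq> b \<and> b \<noteq> c \<and> a \<noteq> c"
proof -
  have same: "crossing z d u v = 0" if "side z d u = side z d v" for u v
    using that by (simp add: crossing_def)
  consider "side z d a = side z d b" "side z d b = side z d c"
    | "side z d a \<noteq> side z d b" "side z d b = side z d c"
    | "side z d b \<noteq> side z d c" "side z d c = side z d a"
    | "side z d c \<noteq> side z d a" "side z d a = side z d b"
    by blast
  then have "\<bar>w\<bar> \<le> 1 \<and> (w \<noteq> 0 \<longrightarrow> z \<in> convex hull {a, b, c})"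
  proof cases
    case 1 then show ?thesis by (simp add: w_def same)
  next
    case 2
    then show ?thesis using crossing_two_sides[OF assms(1) 2] by (simp add: w_def same)
  next
    case 3
    then show ?thesis using crossing_two_sides[OF assms(1) 3]
      by (simp add: w_def same insert_commute add.commute)
  next
    case 4
    then show ?thesis using crossing_two_sides[OF assms(1) 4]
      by (simp add: w_def same insert_commute add.commute)
  qed
  \<comment> \<open>If two corners coincide, one side degenerates and the other two are reverses of
    each other. A nonzero \<open>w\<close> thus forces distinct corners, and later distinct
    labels.\<close>
  moreover have "w = 0" if "a = b \<or> b = c \<or> a = c"
    using that crossing_antisym[of z d a b] crossing_antisym[of z d b c] crossing_antisym[of z d c a]
      crossing_antisym[of z d a a] crossing_antisym[of z d b b]
    by (auto simp: w_def)
  ultimately show "\<bar>w\<bar> \<le> 1" "w \<noteq> 0 \<Longrightarrow> z \<in> convex hull {a, b, c} \<and> a \<noteq> b \<and> b \<noteq> c \<and> a \<noteq> c"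
    by auto
qed

section \<open>Labellings by a convex polygon\<close>

text \<open>Splitting off the first edge writes the polygon as a simple loop of two arcs. These meet
  only at their ends, and the midpoint of a nondegenerate edge is not an end.\<close>

lemma simple_polygon_first_edge:
  assumes "simple_polygon vs"
  shows "vs ! 0 \<noteq> vs ! 1"
    and "\<lbrakk>1 \<le> j; j < length vs\<rbrakk> \<Longrightarrow>
      midpoint (vs ! 0) (vs ! 1) \<notin> closed_segment (vs ! j) (vs ! (Suc j mod length vs))"
proof -
  obtain a b c ws where vs: "vs = a # b # c # ws"
    using assms by (auto simp: simple_polygon_def numeral_3_eq_3 Suc_le_length_iff)
  define us where "us = b # c # ws @ [a]"
  have len: "2 \<le> length us" by (simp add: us_def)
  have "polygon_path vs = linepath a b +++ polygonal_path us"
    by (simp add: polygon_path_def vs us_def)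
  then have "simple_path (linepath a b +++ polygonal_path us)"
    using assms by (simp add: simple_polygon_def)
  moreover have "pathstart (polygonal_path us) = b" "pathfinish (polygonal_path us) = a"
    using pathstart_polygonal_path[OF len] pathfinish_polygonal_path[OF len] by (simp_all add: us_def)
  ultimately have arc: "arc (linepath a b)"
    and sub: "closed_segment a b \<inter> path_image (polygonal_path us) \<subseteq> {a, b}"
    by (simp_all add: simple_path_join_loop_eq)
  from arc have "a \<noteq> b" using arc_distinct_ends by fastforce
  then show "vs ! 0 \<noteq> vs ! 1" by (simp add: vs)
  assume j: "1 \<le> j" "j < length vs"
  have "closed_segment (vs ! j) (vs ! (Suc j mod length vs)) \<subseteq> path_image (polygonal_path us)"
  proof -
    have "vs @ [hd vs] = a # us" by (simp add: vs us_def)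
    then have "vs ! j = us ! (j - 1)" "vs ! (Suc j mod length vs) = us ! Suc (j - 1)"
      using nth_append_hd[OF j(2)] j(1) by (simp_all add: nth_Cons')
    moreover have "j - 1 < length us - 1" using j by (simp add: vs us_def)
    ultimately show ?thesis unfolding path_image_polygonal_path[OF len] by auto
  qed
  moreover have "midpoint a b \<in> closed_segment a b" "midpoint a b \<notin> {a, b}"
    using \<open>a \<noteq> b\<close> by auto
  ultimately have "midpoint a b \<notin> closed_segment (vs ! j) (vs ! (Suc j mod length vs))"
    using sub by blast
  then show "midpoint (vs ! 0) (vs ! 1) \<notin> closed_segment (vs ! j) (vs ! (Suc j mod length vs))"
    by (simp add: vs)
qed

text \<open>Of two boundary points on a ray from an interior point, the nearer would lie on the open
  segment to the farther; by convexity that segment is interior to the polygon.\<close>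

lemma ray_meets_boundary_once:
  assumes simple: "simple_polygon vs"
    and conv: "convex (polygon_boundary vs \<union> inside (polygon_boundary vs))"
    and z: "z \<in> inside (polygon_boundary vs)" and m: "m \<in> polygon_boundary vs"
    and r: "0 \<le> r" "z + of_real r * (m - z) \<in> polygon_boundary vs"
  shows "z + of_real r * (m - z) = m"
proof -
  let ?B = "polygon_boundary vs" and ?w = "z + of_real r * (m - z)"
  let ?P = "?B \<union> inside ?B"
  note J = Jordan_inside_outside[OF simple_polygonD(2,3)[OF simple]]
  have "inside ?B \<subseteq> interior ?P" using J by (intro interior_maximal) auto
  then have z': "z \<in> interior ?P" using z by blast
  \<comment> \<open>The boundary is also the frontier of the outside, which \<open>?P\<close>
    misses, so no boundary point is interior to \<open>?P\<close>.\<close>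
  have disj: "interior ?P \<inter> ?B = {}"
  proof -
    have "outside ?B \<inter> ?P = {}" using J outside_no_overlap[of ?B] by blast
    then have "interior ?P \<inter> outside ?B = {}" using interior_subset by blast
    then have "interior ?P \<inter> closure (outside ?B) = {}" by (simp add: open_Int_closure_eq_empty)
    then show ?thesis using J by (auto simp: frontier_def)
  qed
  have seg: "open_segment z x \<subseteq> interior ?P" if "x \<in> ?B" for x
    using in_interior_closure_convex_segment[OF conv z', of x] that closure_subset by blast
  have "z \<notin> ?B" using z' disj by blast
  then have "z \<noteq> m" "r \<noteq> 0" using m r by auto
  have "\<not> r < 1"
  proof
    assume "r < 1"
    then have "?w \<in> open_segment z m"
      using \<open>z \<noteq> m\<close> \<open>r \<noteq> 0\<close> r(1) unfolding in_segment
      by (intro conjI exI[of _ r]) (auto simp: scaleR_conv_of_real algebra_simps)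
    then show False using seg[OF m] r(2) disj by blast
  qed
  moreover have "\<not> 1 < r"
  proof
    assume "1 < r"
    then have "m \<in> open_segment z ?w"
      using \<open>z \<noteq> m\<close> unfolding in_segment
      by (intro conjI exI[of _ "1 / r"]) (auto simp: scaleR_conv_of_real field_simps)
    then show False using seg[OF r(2)] m disj by blast
  qed
  ultimately have "r = 1" by simp
  then show ?thesis by simp
qed

lemma convex_polygon_edges:
  assumes "convex_polygon P n y"
  defines "vs \<equiv> map y [1..<Suc n]"
  shows "3 \<le> n" "simple_polygon vs"
    "\<And>j. \<lbrakk>1 \<le> j; j < n\<rbrakk> \<Longrightarrow> vs ! (j - 1) = y j \<and> vs ! (Suc (j - 1) mod length vs) = y (Suc j)"
    "vs ! (n - 1) = y n \<and> vs ! (Suc (n - 1) mod length vs) = y 1"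
proof -
  show s: "simple_polygon vs" using assms by (simp add: convex_polygon_def Let_def)
  then show "3 \<le> n" by (simp add: simple_polygon_def vs_def del: upt_Suc)
  then show "\<And>j. \<lbrakk>1 \<le> j; j < n\<rbrakk> \<Longrightarrow> vs ! (j - 1) = y j \<and> vs ! (Suc (j - 1) mod length vs) = y (Suc j)"
    "vs ! (n - 1) = y n \<and> vs ! (Suc (n - 1) mod length vs) = y 1"
    by (simp_all add: vs_def del: upt_Suc)
qed

text \<open>The ray from \<open>z\<close> through the midpoint of \<open>y 1\<close> and \<open>y 2\<close> leaves the polygon there, hence
  meets no other edge. This is what makes the crossing number count precisely the label changes
  between 1 and 2.\<close>

lemma convex_polygon_crossing:
  assumes P: "convex_polygon P n y"
  defines "B \<equiv> polygon_boundary (map y [1..<Suc n])"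
  assumes z: "z \<in> inside B"
  obtains d \<sigma> where "d \<noteq> 0" "\<bar>\<sigma>\<bar> = 1"
    "\<And>a b. \<lbrakk>a \<in> {1..n}; b \<in> {1..n}; a = b \<or> neighbors n a b\<rbrakk> \<Longrightarrow>
       crossing z d (y a) (y b) = \<sigma> * (of_bool (a = 1 \<and> b = 2) - of_bool (a = 2 \<and> b = 1))"
proof -
  define vs where "vs = map y [1..<Suc n]"
  note V = convex_polygon_edges[OF P, folded vs_def]
  have n: "3 \<le> n" by (rule V)
  have len: "length vs = n" by (simp add: vs_def)
  have B: "B = polygon_boundary vs" by (simp add: B_def vs_def)
  have conv: "convex (polygon_boundary vs \<union> inside (polygon_boundary vs))"
    using P unfolding convex_polygon_def Let_def vs_def by metis
  have vs01: "vs ! 0 = y 1" "vs ! 1 = y 2" "y 1 \<noteq> y 2"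
    using V(3)[of 1] V(3)[of 2] simple_polygon_first_edge(1)[OF V(2)] n by (auto simp: numeral_2_eq_2)
  define m where "m = midpoint (y 1) (y 2)"
  define d where "d = m - z"
  have edge_B: "closed_segment (vs ! j) (vs ! (Suc j mod length vs)) \<subseteq> B" if "j < n" for j
    using that unfolding B polygon_boundary_eq[OF simple_polygonD(1)[OF V(2)]] len by auto
  have m_off: "m \<notin> closed_segment (vs ! j) (vs ! (Suc j mod length vs))" if "1 \<le> j" "j < n" for j
    using simple_polygon_first_edge(2)[OF V(2)] that by (simp add: m_def vs01 len del: One_nat_def)
  have y12: "closed_segment (y 1) (y 2) \<subseteq> B"
    using edge_B[of 0] V(3)[of 1] n by (simp add: numeral_2_eq_2)
  have m_B: "m \<in> B" using y12 by (auto simp: m_def)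
  have once: "z + of_real r * d = m" if "0 \<le> r" "z + of_real r * d \<in> B" for r
    using ray_meets_boundary_once[OF V(2) conv] that m_B z by (simp add: B d_def)
  have d0: "d \<noteq> 0"
  proof -
    have "z \<notin> B" using z inside_no_overlap[of B] by blast
    then show ?thesis using m_B by (auto simp: d_def)
  qed
  have far: "crossing z d (vs ! j) (vs ! (Suc j mod length vs)) = 0" if "1 \<le> j" "j < n" for j
  proof (rule crossing_not_hits)
    show "\<not> hits_ray z d (vs ! j) (vs ! (Suc j mod length vs))"
      using once edge_B[of j] m_off[OF that] that unfolding hits_ray_def by (metis subsetD)
  qed
  have succ: "crossing z d (y j) (y (Suc j)) = 0" if "2 \<le> j" "j < n" for j
    using far[of "j - 1"] V(3)[of j] that by simp
  have last: "crossing z d (y n) (y 1) = 0"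
    using far[of "n - 1"] V(4) n by simp
  \<comment> \<open>The sign depends on whether the vertices run counterclockwise or clockwise; only
    its absolute value enters the final bound.\<close>
  define \<sigma> where "\<sigma> = crossing z d (y 1) (y 2)"
  have self: "crossing z d p p = 0" for p
    using crossing_antisym[of z d p p] by simp
  have "\<bar>\<sigma>\<bar> = 1"
  proof -
    have "z + of_real 1 * d \<in> closed_segment (y 1) (y 2)" by (simp add: d_def m_def)
    then have hits: "hits_ray z d (y 1) (y 2)" unfolding hits_ray_def by (metis zero_le_one)
    define u where "u = (\<lambda>p. Im ((p - z) * cnj d))"
    have mid: "(y 1 - z) + (y 2 - z) = 2 * d"
      by (simp add: d_def m_def midpoint_def scaleR_conv_of_real)
    have "u (y 1) + u (y 2) = Im (((y 1 - z) + (y 2 - z)) * cnj d)"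
      by (simp add: u_def algebra_simps)
    also have "\<dots> = 0" unfolding mid by simp
    finally have opp: "u (y 2) = - u (y 1)" by simp
    \<comment> \<open>Otherwise \<open>y 1\<close> and \<open>y 2\<close> lie on the line of the ray
      at parameters \<open>r\<close> and \<open>2 - r\<close>. One of these is nonnegative, so that
      corner would be \<open>m\<close>, the only boundary point on the ray.\<close>
    have "u (y 1) \<noteq> 0"
    proof
      assume "u (y 1) = 0"
      then have "(y 1 - z) / d \<in> \<real>"
        by (simp add: u_def complex_is_Real_iff Im_complex_div_eq_0)
      then obtain r where "(y 1 - z) / d = of_real r" by (metis Reals_cases)
      then have y1: "y 1 = z + of_real r * d" using d0 by (simp add: field_simps)
      then have y2: "y 2 = z + of_real (2 - r) * d" using mid by (simp add: algebra_simps)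
      have "y 1 \<in> B" "y 2 \<in> B" using y12 by auto
      then have "m = y 1 \<or> m = y 2"
        using once[of r] once[of "2 - r"] y1 y2 by (cases "0 \<le> r") auto
      then show False using vs01(3) by (auto simp: m_def)
    qed
    then have "side z d (y 1) \<noteq> side z d (y 2)"
      using opp unfolding side_def u_def by linarith
    then show ?thesis using hits by (auto simp: \<sigma>_def crossing_def)
  qed
  moreover have "crossing z d (y a) (y b) = \<sigma> * (of_bool (a = 1 \<and> b = 2) - of_bool (a = 2 \<and> b = 1))"
    if ab: "a \<in> {1..n}" "b \<in> {1..n}" "a = b \<or> neighbors n a b" for a b
  proof -
    have up: "crossing z d (y a) (y b) = (if a = 1 then \<sigma> else 0)" if "b = a + 1" "b \<le> n" "1 \<le> a" for a b
      using that succ[of a] by (auto simp: \<sigma>_def numeral_2_eq_2)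
    consider "a = b" | "b = a + 1" | "a = b + 1" | "a = n" "b = 1" | "a = 1" "b = n"
      using ab(3) by (auto simp: neighbors_def)
    then show ?thesis
    proof cases
      case 1 then show ?thesis by (simp add: self)
    next
      case 2 then show ?thesis using up[of b a] ab by auto
    next
      case 3 then show ?thesis
        using up[of a b] ab crossing_antisym[of z d "y b" "y a"] by auto
    next
      \<comment> \<open>\<open>3 \<le> n\<close> keeps the wrap-around pair \<open>n\<close>, 1
        distinct from the pair 2, 1.\<close>
      case 4 then show ?thesis using last n by auto
    next
      case 5 then show ?thesis
        using last n crossing_antisym[of z d "y 1" "y n"] by auto
    qed
  qed
  ultimately show thesis using that d0 by blast
qed

section \<open>From crossing numbers to degrees and covering triangles\<close>

lemma sum_crossing_neighboring:
  assumes "neighboring n (map L vs)" "\<And>v. v \<in> set vs \<Longrightarrow> L v \<in> {1..n}"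
    and c: "\<And>a b. \<lbrakk>a \<in> {1..n}; b \<in> {1..n}; a = b \<or> neighbors n a b\<rbrakk> \<Longrightarrow>
       c a b = \<sigma> * (of_bool (a = 1 \<and> b = 2) - of_bool (a = 2 \<and> b = 1) :: real)"
  shows "(\<Sum>j<length vs. c (L (vs ! j)) (L (vs ! (Suc j mod length vs))))
    = \<sigma> * of_int (label_deg (map L vs))"
proof -
  define l where "l = (\<lambda>j. L (vs ! j))"
  have mod: "Suc j mod length vs < length vs" if "j < length vs" for j
    using that by (cases "length vs") auto
  have "(\<Sum>j<length vs. c (l j) (l (Suc j mod length vs)))
      = (\<Sum>j<length vs. \<sigma> * (of_bool (l j = 1 \<and> l (Suc j mod length vs) = 2)
                         - of_bool (l j = 2 \<and> l (Suc j mod length vs) = 1)))"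
  proof (intro sum.cong refl)
    fix j assume "j \<in> {..<length vs}"
    then have j: "j < length vs" by simp
    have "l j = l (Suc j mod length vs) \<or> neighbors n (l j) (l (Suc j mod length vs))"
      using assms(1) j mod[OF j] by (auto simp: neighboring_def Let_def l_def)
    then show "c (l j) (l (Suc j mod length vs)) = \<sigma> * (of_bool (l j = 1 \<and> l (Suc j mod length vs) = 2)
                         - of_bool (l j = 2 \<and> l (Suc j mod length vs) = 1))"
      using j mod[OF j] assms(2) by (intro c) (auto simp: l_def)
  qed
  also have "\<dots> = \<sigma> * ((\<Sum>j<length vs. of_bool (l j = 1 \<and> l (Suc j mod length vs) = 2))
                         - (\<Sum>j<length vs. of_bool (l j = 2 \<and> l (Suc j mod length vs) = 1)))"
    unfolding sum_distrib_left[symmetric] sum_subtractf ..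
  also have "\<dots> = \<sigma> * of_int (label_deg (map L vs))"
  proof -
    have "{j. j < length vs \<and> map L vs ! j = a \<and> map L vs ! (Suc j mod length vs) = b}
        = {j \<in> {..<length vs}. l j = a \<and> l (Suc j mod length vs) = b}" for a b
      using mod by (auto simp: l_def)
    then show ?thesis
      by (simp add: label_deg_def sum.inter_filter[symmetric] of_bool_def Int_def conj_ac)
  qed
  finally show ?thesis by (simp add: l_def)
qed

text \<open>The triangles that miss \<open>z\<close> are finitely many closed sets, and
  \<open>z\<close> is in the closure of the inside; a point of the inside close enough to
  \<open>z\<close> avoids them all.\<close>

lemma ex_interior_point_refining_cov:
  assumes P: "convex_polygon P n y" and "z \<in> P"
  obtains z' where "z' \<in> inside (polygon_boundary (map y [1..<Suc n]))"
    "\<And>i j l. \<lbrakk>i \<in> {1..n}; j \<in> {1..n}; l \<in> {1..n}; z' \<in> convex hull {y i, y j, y l}\<rbrakk>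
       \<Longrightarrow> z \<in> convex hull {y i, y j, y l}"
proof -
  let ?B = "polygon_boundary (map y [1..<Suc n])"
  \<comment> \<open>Indices may repeat, so degenerate triangles are avoided as well.\<close>
  define F where "F = {K. z \<notin> K \<and> (\<exists>i\<in>{1..n}. \<exists>j\<in>{1..n}. \<exists>l\<in>{1..n}. K = convex hull {y i, y j, y l})}"
  have "finite ((\<lambda>(i, j, l). convex hull {y i, y j, y l}) ` ({1..n} \<times> {1..n} \<times> {1..n}))" by simp
  then have "finite F" by (rule finite_subset[rotated]) (auto simp: F_def)
  moreover have "closed K" if "K \<in> F" for K
    using that by (auto simp: F_def intro!: compact_imp_closed finite_imp_compact_convex_hull)
  ultimately have op: "open (- \<Union>F)" by (intro open_Compl closed_Union) auto
  have "simple_polygon (map y [1..<Suc n])" "z \<in> ?B \<union> inside ?B"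
    using P \<open>z \<in> P\<close> by (simp_all add: convex_polygon_def Let_def)
  then have "z \<in> closure (inside ?B)"
    using Jordan_inside_outside[OF simple_polygonD(2,3)] closure_subset[of "inside ?B"]
    by (metis Diff_subset Un_iff frontier_def subsetD)
  moreover have "z \<in> - \<Union>F" by (auto simp: F_def)
  ultimately have "- \<Union>F \<inter> inside ?B \<noteq> {}"
    using open_Int_closure_eq_empty[OF op, of "inside ?B"] by blast
  then obtain z' where "z' \<in> inside ?B" "z' \<notin> \<Union>F" by blast
  show thesis
  proof (rule that[OF \<open>z' \<in> inside ?B\<close>])
    fix i j l assume "i \<in> {1..n}" "j \<in> {1..n}" "l \<in> {1..n}" "z' \<in> convex hull {y i, y j, y l}"
    then show "z \<in> convex hull {y i, y j, y l}"
      using \<open>z' \<notin> \<Union>F\<close> unfolding F_def by blast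
  qed
qed

text \<open>Affine independence makes the corners the extreme points of \<open>S\<close>. Sorting
  the three distinct labels gives \<open>i < j < l\<close> without changing the hull.\<close>

lemma labelled_in_cov_triple:
  assumes "S = convex hull {a, b, c}" "\<not> affine_dependent {a, b, c}"
    and "L a \<in> {1..n}" "L b \<in> {1..n}" "L c \<in> {1..n}" "L a \<noteq> L b" "L b \<noteq> L c" "L a \<noteq> L c"
    and z: "z \<in> convex hull {y (L a), y (L b), y (L c)}"
  shows "labelled_in_cov L n y z S"
proof -
  have "{v. v extreme_point_of S} = {a, b, c}"
    using assms(1,2) by (auto simp: extreme_point_of_convex_hull_affine_independent)
  then have img: "L ` {v. v extreme_point_of S} = {L a, L b, L c}" by simp
  obtain i j l where "i < j" "j < l" and eq: "{i, j, l} = {L a, L b, L c}"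
  proof -
    have "card {L a, L b, L c} = 3" using assms by simp
    then show thesis
      using assms that[of "L a" "L b" "L c"] that[of "L a" "L c" "L b"] that[of "L b" "L a" "L c"]
        that[of "L b" "L c" "L a"] that[of "L c" "L a" "L b"] that[of "L c" "L b" "L a"]
      by (auto simp: insert_commute linorder_neq_iff)
  qed
  have "i \<in> {L a, L b, L c}" "j \<in> {L a, L b, L c}" "l \<in> {L a, L b, L c}" using eq by blast+
  then have "1 \<le> i" "l \<le> n" using assms by auto
  have "{y i, y j, y l} = {y (L a), y (L b), y (L c)}"
    using arg_cong[OF eq, of "image y"] by simp
  then have "z \<in> convex hull {y i, y j, y l}" using z by simp
  then have "convex hull {y i, y j, y l} \<in> cov n y z"
    using \<open>i < j\<close> \<open>j < l\<close> \<open>1 \<le> i\<close> \<open>l \<le> n\<close> unfolding cov_def by blast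
  then show ?thesis
    unfolding labelled_in_cov_def img using eq \<open>i < j\<close> \<open>j < l\<close> \<open>1 \<le> i\<close> \<open>l \<le> n\<close> by metis
qed

theorem theorem2p1:
  fixes P :: "complex set" and n :: nat and y :: "nat \<Rightarrow> complex"
    and k :: nat and H :: "nat \<Rightarrow> complex list" and T :: "complex set set"
    and L :: "complex \<Rightarrow> nat" and z :: complex
  assumes "convex_polygon P n y"
    and "polygon_with_holes k H"
    and "triangulates T k H"
    and "z \<in> P"
    and "\<forall>v \<in> vertices T. L v \<in> {1..n}"
    and "L \<in> NL k H n"
  shows "\<bar>boundary_deg L k H\<bar> \<le> int (card {S \<in> triangles T. labelled_in_cov L n y z S})"
proof -
  obtain z' where z': "z' \<in> inside (polygon_boundary (map y [1..<Suc n]))"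
    and cover: "\<And>i j l. \<lbrakk>i \<in> {1..n}; j \<in> {1..n}; l \<in> {1..n}; z' \<in> convex hull {y i, y j, y l}\<rbrakk>
       \<Longrightarrow> z \<in> convex hull {y i, y j, y l}"
    using ex_interior_point_refining_cov[OF assms(1,4)] by blast
  obtain d \<sigma> where d: "d \<noteq> 0" and \<sigma>: "\<bar>\<sigma>\<bar> = 1"
    and cr: "\<And>a b. \<lbrakk>a \<in> {1..n}; b \<in> {1..n}; a = b \<or> neighbors n a b\<rbrakk> \<Longrightarrow>
       crossing z' d (y a) (y b) = \<sigma> * (of_bool (a = 1 \<and> b = 2) - of_bool (a = 2 \<and> b = 1))"
    using convex_polygon_crossing[OF assms(1) z'] by metis
  \<comment> \<open>The crossing number of the image of an edge under
    \<open>v \<mapsto> y (L v)\<close>: an antisymmetric weight for the chain formula.\<close>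
  define g where "g = (\<lambda>u v. crossing z' d (y (L u)) (y (L v)))"
  obtain A B C :: "complex set \<Rightarrow> complex" where ABC: "\<And>S. S \<in> triangles T \<Longrightarrow>
       S = convex hull {A S, B S, C S} \<and> \<not> affine_dependent {A S, B S, C S}"
    and boundary: "\<And>g :: complex \<Rightarrow> complex \<Rightarrow> real. (\<And>a b. g b a = - g a b) \<Longrightarrow>
       (\<Sum>S\<in>triangles T. g (A S) (B S) + g (B S) (C S) + g (C S) (A S))
         = (\<Sum>i\<le>k. \<Sum>j<length (H i). g (H i ! j) (H i ! (Suc j mod length (H i))))"
    using triangulation_boundary_chain[OF assms(2,3)] by blast
  have chain: "(\<Sum>S\<in>triangles T. g (A S) (B S) + g (B S) (C S) + g (C S) (A S))
         = (\<Sum>i\<le>k. \<Sum>j<length (H i). g (H i ! j) (H i ! (Suc j mod length (H i))))"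
    by (rule boundary) (unfold g_def, rule crossing_antisym)
  have sc: "simplicial_complex T" and edges: "\<And>i. i \<le> k \<Longrightarrow> polygon_edges (H i) \<subseteq> T"
    using assms(3) by (auto simp: triangulates_def)
  note D = simplicial_complexD[OF sc]
  \<comment> \<open>An extreme point is a face, hence itself a member of \<open>T\<close>; this
    carries the range of the labels to the boundary cycles and to the corners of triangles.\<close>
  have vertex: "v \<in> vertices T" if "S \<in> T" "v extreme_point_of S" for v S
    using D(3)[OF that(1)] that(2) by (simp add: vertices_def face_of_singleton)
  have lab_H: "L v \<in> {1..n}" if i: "i \<le> k" and v: "v \<in> set (H i)" for i v
  proof -
    obtain j where j: "j < length (H i)" "v = H i ! j" using v by (metis in_set_conv_nth)
    then have "closed_segment v (H i ! (Suc j mod length (H i))) \<in> T"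
      using edges[OF i] by (auto simp: polygon_edges_def)
    then show ?thesis using vertex extreme_point_of_segment assms(5) by blast
  qed
  have lab_T: "L v \<in> {1..n}" if "S \<in> triangles T" "v \<in> {A S, B S, C S}" for S v
    using vertex[of S v] that ABC[OF that(1)] assms(5) extreme_point_of_convex_hull_affine_independent
    by (metis (no_types, lifting) mem_Collect_eq triangles_def)
  define w where "w = (\<lambda>S. g (A S) (B S) + g (B S) (C S) + g (C S) (A S))"
  have "(\<Sum>S\<in>triangles T. w S) = (\<Sum>i\<le>k. \<sigma> * of_int (label_deg (map L (H i))))"
    unfolding w_def chain unfolding g_def
  proof (intro sum.cong refl sum_crossing_neighboring[where c = "\<lambda>a b. crossing z' d (y a) (y b)"])
    fix i assume "i \<in> {..k}"
    then show "neighboring n (map L (H i))" "\<And>v. v \<in> set (H i) \<Longrightarrow> L v \<in> {1..n}"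
      using assms(6) lab_H by (auto simp: NL_def)
  qed (rule cr)
  then have "\<sigma> * of_int (boundary_deg L k H) = (\<Sum>S\<in>triangles T. w S)"
    by (simp add: boundary_deg_def sum_distrib_left)
  \<comment> \<open>Absolute values remove the orientation sign \<open>\<sigma>\<close>.\<close>
  then have "\<bar>real_of_int (boundary_deg L k H)\<bar> = \<bar>\<Sum>S\<in>triangles T. w S\<bar>"
    using \<sigma> by (metis abs_mult mult_1)
  also have "\<dots> \<le> (\<Sum>S\<in>triangles T. \<bar>w S\<bar>)" by (rule sum_abs)
  \<comment> \<open>A triangle contributes at most 1 in absolute value. A nonzero contribution means
    distinct labels and an image triangle containing \<open>z'\<close>, hence containing
    \<open>z\<close>.\<close>
  also have "\<dots> \<le> (\<Sum>S\<in>triangles T. of_bool (labelled_in_cov L n y z S))"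
  proof (rule sum_mono)
    fix S assume S: "S \<in> triangles T"
    note tri = crossing_triangle[OF d, of z' "y (L (A S))" "y (L (B S))" "y (L (C S))"]
    have "labelled_in_cov L n y z S" if "w S \<noteq> 0"
    proof -
      have ne: "z' \<in> convex hull {y (L (A S)), y (L (B S)), y (L (C S))}"
        "L (A S) \<noteq> L (B S)" "L (B S) \<noteq> L (C S)" "L (A S) \<noteq> L (C S)"
        using tri(2) that by (auto simp: w_def g_def)
      show ?thesis
        using ABC[OF S] lab_T[OF S] ne cover by (intro labelled_in_cov_triple[of S "A S" "B S" "C S"]) auto
    qed
    then show "\<bar>w S\<bar> \<le> of_bool (labelled_in_cov L n y z S)"
      using tri(1) by (auto simp: w_def g_def)
  qed
  also have "\<dots> = of_nat (card {S \<in> triangles T. labelled_in_cov L n y z S})"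
    using D(1) by (simp add: triangles_def Int_def conj_ac)
  finally show ?thesis by linarith
qed

end
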